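(* Let $D$ be a digraph on $n$ vertices which either has diameter $2$ or is a bipartite digraph of diameter $3$. Then $c(D)\leq\sqrt{2n}$.
   Context: A digraph has diameter $2$ if for any two vertices $u,v$ there is a directed path from $u$ to $v$ of length at most $2$; a bipartite digraph (vertex set partitioned into two parts with every arc joining the two parts) has diameter $3$ if for any two vertices $u,v$ there is a directed path from $u$ to $v$ of length at most $3$. Cops and Robbers on a digraph $D$: first each of $k$ cops chooses an initial vertex, then the robber chooses one. Then the players alternate, starting with the cops: in a cops' turn every cop either stays or moves from its vertex $x$ to an out-neighbour $y$ (along an arc $x\to y$), and in the robber's turn the robber stays or moves along an arc to an out-neighbour. Several cops may occupy the same vertex; full information. The cops win if, whatever the robber does, after some cops' move some cop occupies the robber's vertex. $c(D)$ is the least $k$ for which the cops win. *)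

theory Defs
  imports Complex_Main "Graph_Theory.Graph_Theory"
begin

text \<open>Following the usual convention for diameter-two graphs, the bound on the
  directed distances is an upper bound only; it need not be attained.\<close>

definition has_diameter :: "('a, 'b) pre_digraph \<Rightarrow> nat \<Rightarrow> bool" where
  "has_diameter D d \<longleftrightarrow>
    (\<forall>u\<in>verts D. \<forall>v\<in>verts D. \<exists>p. pre_digraph.apath D u p v \<and> length p \<le> d)"

definition bipartite_digraph :: "('a, 'b) pre_digraph \<Rightarrow> bool" where
  "bipartite_digraph D \<longleftrightarrow>
    (\<exists>A B. A \<union> B = verts D \<and> A \<inter> B = {} \<and>
      (\<forall>e\<in>arcs D. tail D e \<in> A \<and> head D e \<in> B \<or> tail D e \<in> B \<and> head D e \<in> A))"

definition legal_move :: "('a, 'b) pre_digraph \<Rightarrow> 'a \<Rightarrow> 'a \<Rightarrow> bool" where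
  "legal_move D x y \<longleftrightarrow> y = x \<or> x \<rightarrow>\<^bsub>D\<^esub> y"

text \<open>\<open>r t\<close> is the robber's vertex after \<open>t\<close> robber moves, \<open>r 0\<close> being the initial choice.
  Since staying is always legal, it suffices to consider infinite trajectories.\<close>

definition robber_trajectory :: "('a, 'b) pre_digraph \<Rightarrow> (nat \<Rightarrow> 'a) \<Rightarrow> bool" where
  "robber_trajectory D r \<longleftrightarrow> r 0 \<in> verts D \<and> (\<forall>t. legal_move D (r t) (r (Suc t)))"

text \<open>A strategy of the cops maps the list of all robber positions seen so far, in
  chronological order, to the list of the cops' vertices. Their own earlier positions are
  determined by the strategy and that list, so this is a general history-dependent strategy.
  The empty list yields the initial placement, chosen before the robber's.\<close>

definition cops_position :: "('a list \<Rightarrow> 'a list) \<Rightarrow> (nat \<Rightarrow> 'a) \<Rightarrow> nat \<Rightarrow> 'a list" where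
  "cops_position s r t = s (map r [0..<t])"

definition cop_strategy :: "('a, 'b) pre_digraph \<Rightarrow> nat \<Rightarrow> ('a list \<Rightarrow> 'a list) \<Rightarrow> bool" where
  "cop_strategy D k s \<longleftrightarrow>
    length (s []) = k \<and> set (s []) \<subseteq> verts D \<and>
    (\<forall>r. robber_trajectory D r \<longrightarrow>
      (\<forall>t. list_all2 (legal_move D) (cops_position s r t) (cops_position s r (Suc t))))"

text \<open>The robber stands on \<open>r t\<close> right after the cops' move number \<open>Suc t\<close>.\<close>

definition cops_win :: "('a, 'b) pre_digraph \<Rightarrow> nat \<Rightarrow> bool" where
  "cops_win D k \<longleftrightarrow>
    (\<exists>s. cop_strategy D k s \<and>
      (\<forall>r. robber_trajectory D r \<longrightarrow> (\<exists>t. r t \<in> set (cops_position s r (Suc t)))))"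

definition cop_number :: "('a, 'b) pre_digraph \<Rightarrow> nat" where
  "cop_number D = (LEAST k. cops_win D k)"

lemma cops_win_card_verts:
  assumes "finite (verts D)"
  shows "cops_win D (card (verts D))"
proof -
  obtain xs where xs: "set xs = verts D" "length xs = card (verts D)"
    using assms finite_distinct_list distinct_card by metis
  have "cop_strategy D (card (verts D)) (\<lambda>_. xs)"
    using xs by (auto simp: cop_strategy_def cops_position_def legal_move_def
        intro: list_all2_refl)
  then show ?thesis
    using xs by (auto simp: cops_win_def cops_position_def robber_trajectory_def)
qed

lemma cops_win_cop_number:
  "finite (verts D) \<Longrightarrow> cops_win D (cop_number D)"
  unfolding cop_number_def by (rule LeastI) (rule cops_win_card_verts)

end

theory Submission
  imports Defs
begin

text \<open>Let \<open>m\<close> be the integer part of \<open>sqrt (2 * n)\<close>. Place stationary cops greedily: as long as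
  \<open>s < m\<close> cops have been placed and some closed out-neighbourhood contains more than \<open>m - s\<close>
  vertices not yet dominated, put the next cop there. If this went on for \<open>m\<close> rounds, at least
  \<open>(m + 1) + m + \<dots> + 2 = m * (m + 3) / 2 > n\<close> vertices would be dominated. So it stops with
  \<open>s < m\<close>, and wherever the robber stands there are at most \<open>m - s\<close> undominated vertices where
  he can be after his next move; the remaining \<open>m - s\<close> cops are assigned to these.

  In diameter 2, each remaining cop can move to within distance one of its assigned vertex, so
  the robber is caught at the second move. In the bipartite case one remaining cop is a chaser
  and the others are guards, all starting on the same side. The chaser walks towards the robber
  as long as he stays put, so he must move; hence at some point he is on the side opposite to the
  guards. His out-neighbours are then on the guards' side, so within distance two of them, and the
  guards can cover all his exits while the chaser comes to capture him.\<close>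

section \<open>Winning positions\<close>

text \<open>\<open>cops_win_within D N cs v\<close>: with cops on \<open>cs\<close>, robber on \<open>v\<close> and the cops to move, the cops
  can force a capture within \<open>N\<close> of their moves.\<close>

primrec cops_win_within :: "('a, 'b) pre_digraph \<Rightarrow> nat \<Rightarrow> 'a list \<Rightarrow> 'a \<Rightarrow> bool" where
  "cops_win_within D 0 cs v \<longleftrightarrow> False"
| "cops_win_within D (Suc N) cs v \<longleftrightarrow>
    (\<exists>cs'. list_all2 (legal_move D) cs cs' \<and>
      (v \<in> set cs' \<or> (\<forall>v'. legal_move D v v' \<longrightarrow> cops_win_within D N cs' v')))"

lemma legal_move_refl [simp]: "legal_move D x x"
  by (simp add: legal_move_def)

lemma list_all2_legal_move_refl [simp]: "list_all2 (legal_move D) cs cs"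
  by (simp add: list_all2_refl)

lemma cops_win_within_Suc:
  "cops_win_within D N cs v \<Longrightarrow> cops_win_within D (Suc N) cs v"
proof (induction N arbitrary: cs v)
  case (Suc N)
  then obtain cs' where "list_all2 (legal_move D) cs cs'"
    and "v \<in> set cs' \<or> (\<forall>v'. legal_move D v v' \<longrightarrow> cops_win_within D N cs' v')"
    by auto
  with Suc.IH show ?case
    unfolding cops_win_within.simps(2)[of D "Suc N"] by blast
qed simp

lemma cops_win_within_mono:
  assumes "cops_win_within D M cs v" "M \<le> N"
  shows "cops_win_within D N cs v"
  using assms(2)
proof (induction N rule: dec_induct)
  case base
  show ?case by (rule assms(1))
next
  case (step N)
  from step.IH show ?case by (rule cops_win_within_Suc)
qed

lemma cops_win_within_adjacent:
  assumes "c \<in> set cs" "legal_move D c v"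
  shows "cops_win_within D 1 cs v"
proof -
  obtain as bs where cs: "cs = as @ c # bs"
    using assms(1) split_list by metis
  have "list_all2 (legal_move D) cs (as @ v # bs)"
    unfolding cs using assms(2) by (auto intro!: list_all2_appendI)
  then show ?thesis
    unfolding One_nat_def cops_win_within.simps by (metis in_set_conv_decomp)
qed

text \<open>The strategy replays the history: it folds over the robber's positions, carrying the
  number of moves left and picking a winning move by choice at each turn.\<close>

lemma cops_win_if_cops_win_within:
  assumes "set cs \<subseteq> verts D"
    and win: "\<And>v. v \<in> verts D \<Longrightarrow> cops_win_within D N cs v"
  shows "cops_win D (length cs)"
proof -
  define good where "good n cs v cs' \<longleftrightarrow> list_all2 (legal_move D) cs cs' \<and>
      (v \<in> set cs' \<or> (\<forall>v'. legal_move D v v' \<longrightarrow> cops_win_within D (n - 1) cs' v'))"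
    for n cs v cs'
  \<comment> \<open>Standing still is the fallback when no good move exists, as may happen after a
    capture; it keeps the strategy legal on every trajectory.\<close>
  define move where "move n cs v = (if \<exists>cs'. good n cs v cs' then SOME cs'. good n cs v cs' else cs)"
    for n cs v
  define play where "play = foldl (\<lambda>(n, cs) v. (n - 1, move n cs v)) (N, cs)"
  have good_move: "good n cs v (move n cs v)" if "good n cs v cs'" for n cs v cs'
    using that someI[of "good n cs v"] by (auto simp: move_def)
  have legal: "list_all2 (legal_move D) cs (move n cs v)" for n cs v
    using good_move[of n cs v] by (cases "\<exists>cs'. good n cs v cs'") (auto simp: good_def move_def)
  have play_Suc: "play (map r [0..<Suc t]) = (fst (play (map r [0..<t])) - 1,
      move (fst (play (map r [0..<t]))) (snd (play (map r [0..<t]))) (r t))" for r t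
    by (simp add: play_def case_prod_beta)
  have play_fst: "fst (play (map r [0..<t])) = N - t" for r t
  proof (induction t)
    case (Suc t)
    then show ?case unfolding play_Suc by simp
  qed (simp add: play_def)
  let ?s = "\<lambda>h. snd (play h)"
  have step: "cops_position ?s r (Suc t) = move (N - t) (cops_position ?s r t) (r t)" for r t
    unfolding cops_position_def play_Suc play_fst by simp
  have "cop_strategy D (length cs) ?s"
    unfolding cop_strategy_def step using legal assms(1) by (auto simp: play_def)
  moreover have "\<exists>t. r t \<in> set (cops_position ?s r (Suc t))" if r: "robber_trajectory D r" for r
  proof (rule ccontr)
    assume free: "\<not> ?thesis"
    \<comment> \<open>While the robber is free, the guarantee is inherited with one move fewer; at
      \<open>t = N\<close> it is contradictory.\<close>
    have "cops_win_within D (N - t) (cops_position ?s r t) (r t)" for t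
    proof (induction t)
      case 0
      then show ?case
        using win r by (simp add: robber_trajectory_def cops_position_def play_def)
    next
      case (Suc t)
      then obtain n where n: "N - t = Suc n"
        by (cases "N - t") auto
      with Suc obtain cs' where "good (N - t) (cops_position ?s r t) (r t) cs'"
        by (auto simp: good_def)
      then have "good (N - t) (cops_position ?s r t) (r t) (cops_position ?s r (Suc t))"
        unfolding step by (rule good_move)
      with free r show ?case
        by (auto simp: good_def robber_trajectory_def)
    qed
    from this[of N] show False by simp
  qed
  ultimately show ?thesis
    unfolding cops_win_def by blast
qed

section \<open>Guards, chasers and stationary cops\<close>

text \<open>Any guard can serve any target, so no matching argument is needed: the first guard takes
  an arbitrary target, induction handles the rest, and surplus guards stay.\<close>

lemma guards_move:
  assumes "finite U" "card U \<le> length gs"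
    and "\<And>g u. g \<in> set gs \<Longrightarrow> u \<in> U \<Longrightarrow> \<exists>w. legal_move D g w \<and> legal_move D w u"
  shows "\<exists>gs'. list_all2 (legal_move D) gs gs' \<and> (\<forall>u\<in>U. \<exists>g\<in>set gs'. legal_move D g u)"
  using assms
proof (induction gs arbitrary: U)
  case Nil
  then show ?case by auto
next
  case (Cons g gs)
  show ?case
  proof (cases "U = {}")
    case True
    then show ?thesis by (auto intro!: exI[of _ "g # gs"])
  next
    case False
    then obtain u where u: "u \<in> U" by auto
    obtain w where w: "legal_move D g w" "legal_move D w u"
      using Cons.prems(3)[of g u] u by auto
    have "\<exists>gs'. list_all2 (legal_move D) gs gs' \<and> (\<forall>u\<in>U - {u}. \<exists>g\<in>set gs'. legal_move D g u)"
      using Cons.prems u by (intro Cons.IH) auto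
    then obtain gs' where "list_all2 (legal_move D) gs gs'"
      "\<forall>u\<in>U - {u}. \<exists>g\<in>set gs'. legal_move D g u" by blast
    with w show ?thesis by (intro exI[of _ "w # gs'"]) auto
  qed
qed

text \<open>Induction on the length \<open>n\<close> of a walk from the chaser to the robber: each
  turn the robber stays, the chaser follows one more arc, and a departure is met by the last
  hypothesis. The extra turn in \<open>Suc m\<close> serves the base case
  \<open>c = v\<close>.\<close>

lemma (in wf_digraph) chaser_wins_within:
  assumes "(c, v) \<in> arcs_ends G ^^ n" "c \<in> verts G"
    and "\<And>c' u. c' \<in> verts G \<Longrightarrow> v \<rightarrow>\<^bsub>G\<^esub> u \<Longrightarrow> cops_win_within G m (c' # cs) u"
  shows "cops_win_within G (n + Suc m) (c # cs) v"
  using assms(1,2)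
proof (induction n arbitrary: c)
  case 0
  then show ?case by (auto intro!: exI[of _ "c # cs"])
next
  case (Suc n)
  from Suc.prems(1) obtain c' where c': "c \<rightarrow>\<^bsub>G\<^esub> c'" "(c', v) \<in> arcs_ends G ^^ n"
    by (rule relpow_Suc_E2)
  then have "c' \<in> verts G" by (auto dest: adj_in_verts)
  have "cops_win_within G (n + Suc m) (c' # cs) u" if "legal_move G v u" for u
  proof (cases "u = v")
    case True
    with Suc.IH[OF c'(2) \<open>c' \<in> verts G\<close>] show ?thesis by (simp only:)
  next
    case False
    with that have "v \<rightarrow>\<^bsub>G\<^esub> u" by (simp add: legal_move_def)
    from assms(3)[OF \<open>c' \<in> verts G\<close> this] show ?thesis
      by (rule cops_win_within_mono) simp
  qed
  with c'(1) show ?case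
    unfolding add_Suc cops_win_within.simps(2)
    by (intro exI[of _ "c' # cs"]) (auto simp: legal_move_def)
qed

lemma (in wf_digraph) awalk_imp_relpow:
  "awalk u p v \<Longrightarrow> (u, v) \<in> arcs_ends G ^^ length p"
proof (induction p arbitrary: u)
  case (Cons e p)
  then have "(u, head G e) \<in> arcs_ends G" "(head G e, v) \<in> arcs_ends G ^^ length p"
    by (auto simp: awalk_Cons_iff arcs_ends_def arc_to_ends_def)
  then show ?case
    unfolding length_Cons by (rule relpow_Suc_I2)
qed (simp add: awalk_Nil_iff)

lemma (in wf_digraph) has_diameter_relpow:
  assumes "has_diameter G d" "u \<in> verts G" "v \<in> verts G"
  obtains n where "n \<le> d" "(u, v) \<in> arcs_ends G ^^ n"
  using assms awalk_imp_relpow unfolding has_diameter_def apath_def by metis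

lemma greedy_domination:
  fixes N :: "'a \<Rightarrow> 'a set"
  assumes "finite V" "\<And>v. v \<in> V \<Longrightarrow> N v \<subseteq> V" "2 * card V < m * (m + 3)"
  obtains S where "set S \<subseteq> V" "length S < m"
    "\<And>v. v \<in> V \<Longrightarrow> card (N v - (\<Union>x\<in>set S. N x)) + length S \<le> m"
proof (rule ccontr)
  assume "\<not> thesis"
  with that have neg: "\<exists>v\<in>V. card (N v - (\<Union>x\<in>set S. N x)) + length S > m"
    if "set S \<subseteq> V" "length S < m" for S
    using that by (meson not_less)
  \<comment> \<open>\<open>s * (2 * m + 3 - s)\<close> is twice the sum
    \<open>(m + 1) + m + ... + (m + 2 - s)\<close> of the minimal numbers of vertices newly covered
    in the first \<open>s\<close> rounds.\<close>
  have "\<exists>S. set S \<subseteq> V \<and> length S = s \<and> s * (2 * m + 3 - s) \<le> 2 * card (\<Union>x\<in>set S. N x)"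
    if "s \<le> m" for s
    using that
  proof (induction s)
    case 0
    then show ?case by simp
  next
    case (Suc s)
    then obtain S where S: "set S \<subseteq> V" "length S = s"
      "s * (2 * m + 3 - s) \<le> 2 * card (\<Union>x\<in>set S. N x)" by auto
    let ?U = "\<Union>x\<in>set S. N x"
    obtain v where v: "v \<in> V" "card (N v - ?U) + s > m"
      using neg[OF S(1)] S(2) Suc.prems by auto
    have fin: "finite ?U" "finite (N v)"
      using assms(1,2) S(1) v(1) finite_subset by (auto intro!: finite_subset[OF assms(2)])
    have "card (\<Union>x\<in>set (v # S). N x) = card (?U \<union> (N v - ?U))"
      by (rule arg_cong[of _ _ card]) auto
    also have "\<dots> = card ?U + card (N v - ?U)"
      using fin by (subst card_Un_disjoint) auto
    finally have card: "card (\<Union>x\<in>set (v # S). N x) = card ?U + card (N v - ?U)" .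
    \<comment> \<open>This substitution removes truncated subtraction from the identity
      below.\<close>
    obtain d where d: "m = Suc s + d"
      using Suc.prems le_Suc_ex by blast
    have "Suc s * (2 * m + 3 - Suc s) = s * (2 * m + 3 - s) + 2 * (m + 1 - s)"
      unfolding d by (simp add: algebra_simps)
    also have "\<dots> \<le> 2 * card (\<Union>x\<in>set (v # S). N x)"
      unfolding card distrib_left using S(3) v(2) by (intro add_mono) auto
    finally show ?case
      using S v(1) by (intro exI[of _ "v # S"]) auto
  qed
  from this[of m] obtain S where S: "set S \<subseteq> V"
    "m * (2 * m + 3 - m) \<le> 2 * card (\<Union>x\<in>set S. N x)" by auto
  have "card (\<Union>x\<in>set S. N x) \<le> card V"
    using assms(1,2) S(1) by (intro card_mono) auto
  moreover have "2 * m + 3 - m = m + 3" by simp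
  ultimately show False
    using S(2) assms(3) by simp
qed

section \<open>The bound\<close>

definition closed_out :: "('a, 'b) pre_digraph \<Rightarrow> 'a \<Rightarrow> 'a set" where
  "closed_out D v = {u. legal_move D v u}"

lemma (in wf_digraph) closed_out_subset: "v \<in> verts G \<Longrightarrow> closed_out G v \<subseteq> verts G"
  by (auto simp: closed_out_def legal_move_def dest: adj_in_verts)

text \<open>All free cops may start at one arbitrary vertex \<open>a\<close>, since diameter 2 puts
  every vertex within two moves of it.\<close>

lemma (in fin_digraph) cops_win_diameter_2:
  assumes diam: "has_diameter G 2"
    and S: "set S \<subseteq> verts G" "length S < m"
    and small: "\<And>v. v \<in> verts G \<Longrightarrow>
      card (closed_out G v - (\<Union>x\<in>set S. closed_out G x)) + length S \<le> m"
    and a: "a \<in> verts G"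
  shows "cops_win G m"
proof -
  let ?R = "\<lambda>v. closed_out G v - (\<Union>x\<in>set S. closed_out G x)"
  let ?gs = "replicate (m - length S) a"
  have "cops_win_within G 2 (?gs @ S) v" if v: "v \<in> verts G" for v
  proof -
    have out: "?R v \<subseteq> verts G"
      using closed_out_subset[OF v] by auto
    have two: "\<exists>w. legal_move G a w \<and> legal_move G w u" if u: "u \<in> verts G" for u
    proof -
      obtain n where n: "n \<le> 2" "(a, u) \<in> arcs_ends G ^^ n"
        using has_diameter_relpow[OF diam a u] .
      then consider "n = 0" | "n = 1" | "n = 2" by linarith
      then show ?thesis
        using n(2) by cases (auto simp: legal_move_def numeral_2_eq_2)
    qed
    have "\<exists>gs'. list_all2 (legal_move G) ?gs gs' \<and> (\<forall>u\<in>?R v. \<exists>g\<in>set gs'. legal_move G g u)"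
      using small[OF v] out two finite_subset[OF out] by (intro guards_move) auto
    then obtain gs' where gs': "list_all2 (legal_move G) ?gs gs'"
      "\<forall>u\<in>?R v. \<exists>g\<in>set gs'. legal_move G g u" by blast
    have "cops_win_within G 1 (gs' @ S) u" if "legal_move G v u" for u
    proof -
      have "\<exists>c\<in>set (gs' @ S). legal_move G c u"
        using gs'(2) that by (auto simp: closed_out_def)
      then show ?thesis
        using cops_win_within_adjacent by metis
    qed
    with gs'(1) show ?thesis
      unfolding numeral_2_eq_2 One_nat_def cops_win_within.simps(2)[of _ "Suc 0"]
      by (intro exI[of _ "gs' @ S"]) (simp add: list_all2_appendI)
  qed
  from cops_win_if_cops_win_within[OF _ this] show ?thesis
    using S a by (auto split: if_splits)
qed

lemma (in fin_digraph) cops_win_bipartite_diameter_3: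
  assumes bip: "bipartite_digraph G" and diam: "has_diameter G 3"
    and S: "set S \<subseteq> verts G" "length S < m"
    and small: "\<And>v. v \<in> verts G \<Longrightarrow>
      card (closed_out G v - (\<Union>x\<in>set S. closed_out G x)) + length S \<le> m"
    and a: "a \<in> verts G"
  shows "cops_win G m"
proof -
  let ?R = "\<lambda>v. closed_out G v - (\<Union>x\<in>set S. closed_out G x)"
  let ?gs = "replicate (m - length S - 1) a"
  \<comment> \<open>\<open>A\<close> is whichever side contains \<open>a\<close>, the guards'
    starting vertex.\<close>
  obtain A where A: "a \<in> A" and alt: "\<And>x y. x \<rightarrow>\<^bsub>G\<^esub> y \<Longrightarrow> x \<in> A \<longleftrightarrow> y \<notin> A"
  proof -
    obtain A B where AB: "A \<union> B = verts G" "A \<inter> B = {}"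
      "\<forall>e\<in>arcs G. tail G e \<in> A \<and> head G e \<in> B \<or> tail G e \<in> B \<and> head G e \<in> A"
      using bip unfolding bipartite_digraph_def by blast
    have alt: "x \<in> A \<and> y \<in> B \<or> x \<in> B \<and> y \<in> A" if "x \<rightarrow>\<^bsub>G\<^esub> y" for x y
      using that AB(3) by (auto simp: arcs_ends_def arc_to_ends_def)
    show thesis
    proof (cases "a \<in> A")
      case True
      then show thesis using that[of A] alt AB(2) by blast
    next
      case False
      then show thesis using that[of B] alt AB(1,2) a by blast
    qed
  qed
  have dist3: "\<exists>n\<le>3. (c, v) \<in> arcs_ends G ^^ n" if "c \<in> verts G" "v \<in> verts G" for c v
    using has_diameter_relpow[OF diam that] by blast
  have two: "\<exists>w. legal_move G a w \<and> legal_move G w u" if u: "u \<in> verts G" "u \<in> A" for u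
  proof -
    obtain n where n: "n \<le> 3" "(a, u) \<in> arcs_ends G ^^ n"
      using dist3[OF a u(1)] by blast
    \<comment> \<open>Every arc changes sides, so a walk of length at most 3 from \<open>a\<close>
      to its own side has length 0 or 2.\<close>
    have "(x, y) \<in> arcs_ends G ^^ k \<Longrightarrow> (x \<in> A \<longleftrightarrow> y \<in> A) \<longleftrightarrow> even k" for x y k
      by (induction k arbitrary: y) (use alt in \<open>auto simp: relcomp_unfold\<close>)
    then have "even n" using n(2) A u(2) by blast
    with n(1) consider "n = 0" | "n = 2"
      by (cases "n = 1 \<or> n = 3") (auto, linarith)
    then show ?thesis
      using n(2) by cases (auto simp: legal_move_def numeral_2_eq_2)
  qed
  \<comment> \<open>The \<open>4\<close> is the distance bound 3 plus the extra turn of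
    \<open>chaser_wins_within\<close>.\<close>
  have chase: "cops_win_within G (4 + k) (c # cs) v"
    if "c \<in> verts G" "v \<in> verts G"
      "\<And>c' u. c' \<in> verts G \<Longrightarrow> v \<rightarrow>\<^bsub>G\<^esub> u \<Longrightarrow> cops_win_within G k (c' # cs) u" for c cs v k
  proof -
    obtain n where "n \<le> 3" "(c, v) \<in> arcs_ends G ^^ n"
      using dist3[OF \<open>c \<in> verts G\<close> \<open>v \<in> verts G\<close>] by blast
    then have "cops_win_within G (n + Suc k) (c # cs) v"
      using chaser_wins_within that by blast
    then show ?thesis
      by (rule cops_win_within_mono) (use \<open>n \<le> 3\<close> in simp)
  qed
  have opposite: "cops_win_within G 6 (c # ?gs @ S) v"
    if c: "c \<in> verts G" and v: "v \<in> verts G" "v \<notin> A" for c v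
  proof (cases "v \<in> ?R v")
    \<comment> \<open>Here a stationary cop dominates \<open>v\<close> and captures at once.\<close>
    case False
    then have "cops_win_within G 1 (c # ?gs @ S) v"
      using cops_win_within_adjacent[of _ "c # ?gs @ S"] by (auto simp: closed_out_def)
    then show ?thesis by (rule cops_win_within_mono) simp
  next
    case True
    let ?U = "?R v - {v}"
    have out: "?U \<subseteq> verts G \<inter> A"
      using closed_out_subset[OF v(1)] v(2) alt by (auto simp: closed_out_def legal_move_def)
    have fin: "finite (?R v)"
      using finite_subset[OF closed_out_subset[OF v(1)]] by simp
    \<comment> \<open>The robber's own vertex needs no guard, because the chaser punishes staying;
      this frees the cop used as chaser.\<close>
    have "card ?U \<le> m - length S - 1"
      using small[OF v(1)] True fin by (subst card_Diff_singleton) auto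
    then have "\<exists>gs'. list_all2 (legal_move G) ?gs gs' \<and> (\<forall>u\<in>?U. \<exists>g\<in>set gs'. legal_move G g u)"
    proof (intro guards_move)
      fix g u assume "g \<in> set ?gs" "u \<in> ?U"
      with out have "g = a" "u \<in> verts G" "u \<in> A" by (auto simp del: Diff_iff)
      with two show "\<exists>w. legal_move G g w \<and> legal_move G w u" by simp
    qed (use fin in auto)
    then obtain gs' where gs': "list_all2 (legal_move G) ?gs gs'"
      "\<forall>u\<in>?U. \<exists>g\<in>set gs'. legal_move G g u" by blast
    have exits: "cops_win_within G 1 (c' # gs' @ S) u" if u: "v \<rightarrow>\<^bsub>G\<^esub> u" for c' u
    proof -
      have "u \<noteq> v" using alt[OF u] by auto
      with gs'(2) u have "\<exists>c\<in>set (c' # gs' @ S). legal_move G c u"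
        by (auto simp: closed_out_def legal_move_def)
      then show ?thesis
        using cops_win_within_adjacent by metis
    qed
    then have "cops_win_within G (4 + 1) (c # gs' @ S) v"
      by (intro chase c v)
    moreover have "cops_win_within G (4 + 1) (c # gs' @ S) u" if "v \<rightarrow>\<^bsub>G\<^esub> u" for u
      using exits[OF that] by (rule cops_win_within_mono) simp
    ultimately have "cops_win_within G (Suc (4 + 1)) (c # ?gs @ S) v"
      unfolding cops_win_within.simps(2)[of _ "4 + 1"] using gs'(1)
      by (intro exI[of _ "c # gs' @ S"])
        (auto simp: list_all2_appendI legal_move_def[of _ v] simp del: cops_win_within.simps)
    then show ?thesis by simp
  qed
  \<comment> \<open>If the robber starts on the guards' side, the guards wait while the chaser
    captures him or forces him across.\<close>
  have "cops_win_within G (4 + 6) (a # ?gs @ S) v" if v: "v \<in> verts G" for v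
  proof (cases "v \<in> A")
    case True
    show ?thesis
    proof (rule chase[OF a v])
      fix c' u assume "c' \<in> verts G" "v \<rightarrow>\<^bsub>G\<^esub> u"
      then show "cops_win_within G 6 (c' # ?gs @ S) u"
        using opposite True alt by (auto dest: adj_in_verts)
    qed
  next
    case False
    show ?thesis
      using opposite[OF a v False] by (rule cops_win_within_mono) simp
  qed
  from cops_win_if_cops_win_within[OF _ this] show ?thesis
    using S a by (auto simp: set_replicate_conv_if)
qed

theorem theorem12:
  fixes D :: "('a, 'b) pre_digraph" and n :: nat
  assumes "digraph D"
    and "card (verts D) = n"
    and "has_diameter D 2 \<or> (bipartite_digraph D \<and> has_diameter D 3)"
  shows "real (cop_number D) \<le> sqrt (2 * real n)"
proof -
  interpret digraph D by fact
  define m where "m = nat \<lfloor>sqrt (2 * real n)\<rfloor>"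
  have m_le: "real m \<le> sqrt (2 * real n)"
    unfolding m_def by (simp add: of_nat_floor)
  have "sqrt (2 * real n) < real m + 1"
    unfolding m_def by linarith
  then have "2 * real n < (real m + 1)\<^sup>2"
    using power_strict_mono[of "sqrt (2 * real n)" "real m + 1" 2] by simp
  then have less: "2 * n < (m + 1)\<^sup>2"
    unfolding of_nat_less_iff[where 'a = real, symmetric] by (simp add: add.commute)
  have "cops_win D m"
  proof (cases "n = 0")
    case True
    then show ?thesis
      using cops_win_card_verts[of D] assms(2) by (simp add: m_def)
  next
    case False
    then obtain a where a: "a \<in> verts D"
      using assms(2) by fastforce
    \<comment> \<open>Since \<open>(m + 1)\<^sup>2 = m * (m + 2) + 1\<close>; as \<open>n\<close> is
      nonzero, \<open>m > 0\<close>, which gives the strict bound with \<open>m + 3\<close>.\<close>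
    from less have "2 * n \<le> m * (m + 2)"
      by (simp add: power2_eq_square)
    with False have "2 * card (verts D) < m * (m + 3)"
      unfolding assms(2) by (cases m) (auto simp: algebra_simps)
    then obtain S where "set S \<subseteq> verts D" "length S < m"
      "\<And>v. v \<in> verts D \<Longrightarrow>
        card (closed_out D v - (\<Union>x\<in>set S. closed_out D x)) + length S \<le> m"
      using greedy_domination[of "verts D" "closed_out D" m] closed_out_subset by auto
    with a assms(3) show ?thesis
      using cops_win_diameter_2 cops_win_bipartite_diameter_3 by metis
  qed
  then have "cop_number D \<le> m"
    unfolding cop_number_def by (rule Least_le)
  with m_le show ?thesis by linarith
qed

end
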